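(* Let $n$ be a positive integer, let $a,b\in\mathbb{R}$ with $a<b$, and let $\mu$ be a probability measure on the Borel $\sigma$-algebra $\mathcal{B}([a,b])$ such that $$\int_a^b x^k\,d\mu(x)=\frac{1}{b-a}\int_a^b x^k\,dx,\qquad k=1,\dots,n.$$ If $n$ is odd, then the inequality $$\mathcal{G}_{\frac{n+1}{2}}[a,b](f)\leq\int_a^b f(x)\,d\mu(x)\leq \mathcal{L}_{\frac{n+3}{2}}[a,b](f)$$ is satisfied for all $n$-convex functions $f:[a,b]\to\mathbb{R}$. If $n$ is even, then $$\mathcal{R}_{\frac{n+2}{2}}^l[a,b](f)\leq\int_a^b f(x)\,d\mu(x)\leq\mathcal{R}_{\frac{n+2}{2}}^r[a,b](f)$$ for all $n$-convex functions $f:[a,b]\to\mathbb{R}$.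
   Context: Divided differences of a function $f$ at pairwise distinct points are defined recursively by $f[x_1]=f(x_1)$ and $$f[x_1,\dots,x_m]=\frac{f[x_2,\dots,x_m]-f[x_1,\dots,x_{m-1}]}{x_m-x_1}.$$ For an interval $I\subset\mathbb{R}$, a function $f:I\to\mathbb{R}$ is called $n$-convex (convex of order $n$) if $f[x_1,\dots,x_{n+2}]\geq 0$ for all pairwise distinct $x_1,\dots,x_{n+2}\in I$. Thus $0$-convexity means nondecreasingness and $1$-convexity is ordinary convexity. All integrals $\int_a^b\cdot\,d\mu$ are over the closed interval $[a,b]$. Quadrature operators on $[a,b]$ (normalized, so that they approximate the mean value $\frac{1}{b-a}\int_a^b f(x)\,dx$; the weights sum to $1$). Each has the form $f\mapsto\sum_{i=1}^m\alpha_i f(x_i)$ with distinct nodes $x_1<\dots<x_m$ in $[a,b]$, and is uniquely determined as follows. - $\mathcal{G}_m[a,b]$ ($m\ge 1$), the $m$-point Gauss (Gauss–Legendre) quadrature: the $m$-point rule that equals $\frac{1}{b-a}\int_a^b p(x)\,dx$ for every polynomial $p$ of degree at most $2m-1$. - $\mathcal{L}_m[a,b]$ ($m\ge 2$), the $m$-point Lobatto quadrature: the $m$-point rule having both $a$ and $b$ among its nodes that equals $\frac{1}{b-a}\int_a^b p(x)\,dx$ for every polynomial $p$ of degree at most $2m-3$. - $\mathcal{R}^l_m[a,b]$ (respectively $\mathcal{R}^r_m[a,b]$), the left (respectively right) $m$-point Radau quadrature: the $m$-point rule having $a$ (respectively $b$) among its nodes that equals $\frac{1}{b-a}\int_a^b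 p(x)\,dx$ for every polynomial $p$ of degree at most $2m-2$. For example, $\mathcal{L}_3[a,b](f)=\frac16 f(a)+\frac23 f\left(\frac{a+b}{2}\right)+\frac16 f(b)$ and $\mathcal{R}^l_2[a,b](f)=\frac14 f(a)+\frac34 f\left(\frac{a+2b}{3}\right)$. *)

theory Defs
  imports "HOL-Probability.Probability" "HOL-Computational_Algebra.Polynomial"
begin

text \<open>The value on the empty list is a dummy, and division by zero makes the values on lists with
  repeated points meaningless; only nonempty lists of distinct points are ever used.\<close>

function divided_difference :: "(real \<Rightarrow> real) \<Rightarrow> real list \<Rightarrow> real" where
  "divided_difference f [] = 0"
| "divided_difference f [x] = f x"
| "divided_difference f (x # y # zs) =
     (divided_difference f (y # zs) - divided_difference f (butlast (x # y # zs)))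
       / (last (y # zs) - x)"
  by pat_completeness auto
termination
  by (relation "Wellfounded.measure (\<lambda>(f, xs). length xs)") auto

definition n_convex_on :: "nat \<Rightarrow> real set \<Rightarrow> (real \<Rightarrow> real) \<Rightarrow> bool" where
  "n_convex_on n I f \<longleftrightarrow>
     (\<forall>xs. length xs = n + 2 \<and> distinct xs \<and> set xs \<subseteq> I \<longrightarrow> 0 \<le> divided_difference f xs)"

definition quadrature_with_nodes ::
    "real \<Rightarrow> real \<Rightarrow> nat \<Rightarrow> real set \<Rightarrow> ((real \<Rightarrow> real) \<Rightarrow> real) \<Rightarrow> bool" where
  "quadrature_with_nodes a b m X Q \<longleftrightarrow>
     X \<subseteq> {a..b} \<and> finite X \<and> card X = m \<and> (\<exists>\<alpha>. Q = (\<lambda>f. \<Sum>x\<in>X. \<alpha> x * f x))"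

definition exact_up_to_degree ::
    "real \<Rightarrow> real \<Rightarrow> nat \<Rightarrow> ((real \<Rightarrow> real) \<Rightarrow> real) \<Rightarrow> bool" where
  "exact_up_to_degree a b d Q \<longleftrightarrow>
     (\<forall>p :: real poly. degree p \<le> d \<longrightarrow> Q (poly p) = 1 / (b - a) * integral {a..b} (poly p))"

text \<open>The following operators are meaningful for \<open>a < b\<close> and \<open>m \<ge> 1\<close> (for Lobatto, \<open>m \<ge> 2\<close>),
  where exactly one operator satisfies each description.\<close>

definition Gauss_quadrature :: "nat \<Rightarrow> real \<Rightarrow> real \<Rightarrow> (real \<Rightarrow> real) \<Rightarrow> real" where
  "Gauss_quadrature m a b =
     (THE Q. \<exists>X. quadrature_with_nodes a b m X Q \<and> exact_up_to_degree a b (2 * m - 1) Q)"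

definition Lobatto_quadrature :: "nat \<Rightarrow> real \<Rightarrow> real \<Rightarrow> (real \<Rightarrow> real) \<Rightarrow> real" where
  "Lobatto_quadrature m a b =
     (THE Q. \<exists>X. quadrature_with_nodes a b m X Q \<and> a \<in> X \<and> b \<in> X \<and>
        exact_up_to_degree a b (2 * m - 3) Q)"

definition left_Radau_quadrature :: "nat \<Rightarrow> real \<Rightarrow> real \<Rightarrow> (real \<Rightarrow> real) \<Rightarrow> real" where
  "left_Radau_quadrature m a b =
     (THE Q. \<exists>X. quadrature_with_nodes a b m X Q \<and> a \<in> X \<and>
        exact_up_to_degree a b (2 * m - 2) Q)"

definition right_Radau_quadrature :: "nat \<Rightarrow> real \<Rightarrow> real \<Rightarrow> (real \<Rightarrow> real) \<Rightarrow> real" where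
  "right_Radau_quadrature m a b =
     (THE Q. \<exists>X. quadrature_with_nodes a b m X Q \<and> b \<in> X \<and>
        exact_up_to_degree a b (2 * m - 2) Q)"

end

theory Submission
  imports Defs
begin

text \<open>Let \<open>E \<subseteq> {a, b}\<close> be the set of prescribed nodes of the rule and \<open>Y\<close> the set of its \<open>k\<close> remaining nodes,
  so \<open>n + 1 = 2 * k + card E\<close> in all four cases. Exactness up to degree \<open>n\<close> forces the nodal polynomial
  of \<open>Y\<close> to be orthogonal with respect to the weight \<open>\<bar>\<Prod>e\<in>E. x - e\<bar>\<close>, which determines the rule and
  places \<open>Y\<close> inside the open interval.

  Since \<open>f\<close> need not be differentiable at the nodes, it is not osculated there: for small \<open>h\<close> let \<open>p\<close>
  interpolate \<open>f\<close> at the \<open>n + 1\<close> points of \<open>E\<close>, \<open>Y\<close> and \<open>Y + h\<close>. Then \<open>f - p\<close> is a nonnegative divided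
  difference times the nodal polynomial, which has constant sign outside the intervals \<open>(y, y + h)\<close>;
  on these intervals \<open>f - p\<close> is \<open>O(h)\<close>, because divided differences of order \<open>n\<close> are monotone in
  each point and hence bounded. As \<open>p\<close> agrees with \<open>f\<close> on all nodes, the rule applied to \<open>f\<close> is the integral
  of \<open>p\<close>, and \<open>h\<close> tends to \<open>0\<close>.\<close>

subsection \<open>Divided differences and interpolation\<close>

definition nodal :: "real set \<Rightarrow> real poly" where
  "nodal X = (\<Prod>x\<in>X. [:- x, 1:])"

lemma poly_nodal: "poly (nodal X) t = (\<Prod>x\<in>X. t - x)"
  by (simp add: nodal_def poly_prod)

lemma monic_nodal: "lead_coeff (nodal X) = 1"
  unfolding nodal_def by (induction X rule: infinite_finite_induct) (auto simp: lead_coeff_mult simp del: mult_pCons_left)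

lemma nodal_nonzero: "nodal X \<noteq> 0"
  using monic_nodal[of X] by auto

lemma degree_nodal: "degree (nodal X) = card X"
  unfolding nodal_def
proof (induction X rule: infinite_finite_induct)
  case (insert x F)
  moreover have "(\<Prod>x\<in>F. [:- x, 1:]) \<noteq> 0"
    using insert.hyps by simp
  ultimately show ?case by (simp add: degree_mult_eq del: mult_pCons_left)
qed auto

lemma poly_nodal_eq_0_iff: "finite X \<Longrightarrow> poly (nodal X) t = 0 \<longleftrightarrow> t \<in> X"
  by (simp add: poly_nodal)

lemma nodal_Un: "finite X \<Longrightarrow> finite Y \<Longrightarrow> X \<inter> Y = {} \<Longrightarrow> nodal (X \<union> Y) = nodal X * nodal Y"
  by (simp add: nodal_def prod.union_disjoint)

definition lagrange_basis :: "real set \<Rightarrow> real \<Rightarrow> real poly" where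
  "lagrange_basis X x = smult (1 / (\<Prod>y\<in>X - {x}. x - y)) (nodal (X - {x}))"

lemma poly_lagrange_basis:
  assumes "finite X" "x \<in> X" "z \<in> X"
  shows "poly (lagrange_basis X x) z = (if z = x then 1 else 0)"
  using assms by (auto simp: lagrange_basis_def poly_nodal)

lemma degree_lagrange_basis: "finite X \<Longrightarrow> x \<in> X \<Longrightarrow> degree (lagrange_basis X x) \<le> card X - 1"
  unfolding lagrange_basis_def by (rule order.trans[OF degree_smult_le]) (simp add: degree_nodal)

definition interpolant :: "(real \<Rightarrow> real) \<Rightarrow> real set \<Rightarrow> real poly" where
  "interpolant f X = (\<Sum>x\<in>X. smult (f x) (lagrange_basis X x))"

lemma poly_interpolant: "finite X \<Longrightarrow> z \<in> X \<Longrightarrow> poly (interpolant f X) z = f z"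
  by (simp add: interpolant_def poly_sum poly_lagrange_basis if_distrib[of "(*) _"] cong: if_cong)

lemma degree_interpolant: "finite X \<Longrightarrow> degree (interpolant f X) \<le> card X - 1"
  unfolding interpolant_def
  by (intro degree_sum_le order.trans[OF degree_smult_le degree_lagrange_basis]) auto

lemma interpolant_poly:
  assumes "finite X" "degree p < card X"
  shows "interpolant (poly p) X = p"
proof (rule poly_eqI_degree[of X])
  show "degree (interpolant (poly p) X) < card X"
    using degree_interpolant[OF assms(1), of "poly p"] assms(2) by linarith
qed (use assms in \<open>auto simp: poly_interpolant\<close>)

text \<open>The symmetric closed formula for the divided difference. It takes a set because the
  order of distinct points does not affect the value, so points can be exchanged freely.\<close>

definition ddiff :: "(real \<Rightarrow> real) \<Rightarrow> real set \<Rightarrow> real" where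
  "ddiff f X = (\<Sum>x\<in>X. f x / (\<Prod>y\<in>X - {x}. x - y))"

lemma ddiff_insert:
  assumes "finite X" "x \<notin> X"
  shows "ddiff f (insert x X) =
    f x / (\<Prod>y\<in>X. x - y) + (\<Sum>z\<in>X. f z / ((z - x) * (\<Prod>y\<in>X - {z}. z - y)))"
proof -
  have "insert x X - {x} = X" using assms by auto
  moreover have "(\<Prod>y\<in>insert x X - {z}. z - y) = (z - x) * (\<Prod>y\<in>X - {z}. z - y)" if "z \<in> X" for z
  proof -
    have "insert x X - {z} = insert x (X - {z})" using that assms by auto
    then show ?thesis using assms by simp
  qed
  ultimately show ?thesis using assms by (simp add: ddiff_def)
qed

text \<open>The recursion for any two of the points, not only the first and last of a list. It holds
  term by term: at a common point z it is 1/(z-x) - 1/(z-y) = (x-y)/((z-x)(z-y)), and the terms at x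
  and y each occur on one side of the difference only.\<close>

lemma ddiff_diff:
  assumes "finite X" "x \<notin> X" "y \<notin> X" "x \<noteq> y"
  shows "ddiff f (insert x X) - ddiff f (insert y X) = (x - y) * ddiff f (insert x (insert y X))"
proof -
  let ?w = "\<lambda>z. \<Prod>u\<in>X - {z}. z - u"
  have w: "?w z \<noteq> 0" if "z \<in> X" for z using assms that by simp
  have p: "(\<Prod>u\<in>insert y X - {z}. z - u) = (z - y) * ?w z" if "z \<in> X" for z
  proof -
    have "insert y X - {z} = insert y (X - {z})" using that assms by auto
    then show ?thesis using assms by simp
  qed
  have "ddiff f (insert x (insert y X)) =
      f x / ((x - y) * (\<Prod>u\<in>X. x - u)) + (f y / ((y - x) * (\<Prod>u\<in>X. y - u))
      + (\<Sum>z\<in>X. f z / ((z - x) * ((z - y) * ?w z))))"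
    using assms by (subst ddiff_insert) (auto simp: p)
  moreover have "f z / ((z - x) * ?w z) - f z / ((z - y) * ?w z)
      = (x - y) * (f z / ((z - x) * ((z - y) * ?w z)))" if "z \<in> X" for z
  proof -
    have "z \<noteq> x" "z \<noteq> y" using that assms by auto
    then show ?thesis using w[OF that] by (simp add: divide_simps) (simp add: algebra_simps)
  qed
  then have "(\<Sum>z\<in>X. f z / ((z - x) * ?w z)) - (\<Sum>z\<in>X. f z / ((z - y) * ?w z))
      = (x - y) * (\<Sum>z\<in>X. f z / ((z - x) * ((z - y) * ?w z)))"
    by (simp add: sum_subtractf[symmetric] sum_distrib_left)
  moreover have "(x - y) * (f x / ((x - y) * P)) = f x / P"
    "(x - y) * (f y / ((y - x) * P)) = - (f y / P)" for P
  proof -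
    have "(x - y) / (y - x) = -1" using assms(4) by (simp add: field_simps)
    then have "(x - y) / (y - x) * (f y / P) = - (f y / P)" by simp
    then show "(x - y) * (f y / ((y - x) * P)) = - (f y / P)" by simp
  qed (use assms(4) in simp)
  ultimately show ?thesis
    using assms by (simp add: ddiff_insert distrib_left)
qed

text \<open>Multiplying the closed formula by the product over \<open>X\<close> leaves f(x) from the
  term at x and turns the term at each z into minus the corresponding Lagrange term.\<close>

lemma interpolant_remainder:
  assumes "finite X" "x \<notin> X"
  shows "f x - poly (interpolant f X) x = ddiff f (insert x X) * (\<Prod>z\<in>X. x - z)"
proof -
  have P: "(\<Prod>z\<in>X. x - z) \<noteq> 0" using assms by auto
  have "f z / ((z - x) * (\<Prod>y\<in>X - {z}. z - y)) * (\<Prod>z\<in>X. x - z)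
      = - (f z * poly (lagrange_basis X z) x)" if "z \<in> X" for z
  proof -
    have "z \<noteq> x" using that assms by auto
    moreover have "(\<Prod>z\<in>X. x - z) = (x - z) * (\<Prod>y\<in>X - {z}. x - y)"
      using assms that by (simp add: prod.remove)
    moreover have "(\<Prod>y\<in>X - {z}. z - y) \<noteq> 0" using assms by simp
    ultimately show ?thesis
      by (simp add: lagrange_basis_def poly_nodal divide_simps) (simp add: algebra_simps)
  qed
  then show ?thesis
    using P by (simp add: ddiff_insert[OF assms] interpolant_def poly_sum distrib_right sum_distrib_right sum_negf)
qed

text \<open>The recursive definition drops either the last or the first point. The two shorter lists
  share the middle points, so \<open>ddiff_diff\<close> applies with these as its common
  set.\<close>

lemma divided_difference_eq_ddiff:
  "xs \<noteq> [] \<Longrightarrow> distinct xs \<Longrightarrow> divided_difference f xs = ddiff f (set xs)"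
proof (induction f xs rule: divided_difference.induct)
  case (3 f x y zs)
  obtain ws l where ws: "y # zs = ws @ [l]"
    by (metis list.distinct(1) rev_exhaust)
  have butlast: "butlast (x # y # zs) = x # ws"
    unfolding ws by (simp only: butlast.simps append_is_Nil_conv butlast_snoc) simp
  have last: "last (y # zs) = l" unfolding ws by simp
  have dist: "distinct (x # ws @ [l])" using "3.prems"(2) unfolding ws .
  have "divided_difference f (y # zs) = ddiff f (insert l (set ws))"
    using "3.IH"(1) dist unfolding ws by simp
  moreover have "divided_difference f (butlast (x # y # zs)) = ddiff f (insert x (set ws))"
    using "3.IH"(2) dist unfolding butlast by simp
  ultimately have "divided_difference f (x # y # zs) =
      (ddiff f (insert l (set ws)) - ddiff f (insert x (set ws))) / (l - x)"
    by (simp only: divided_difference.simps last)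
  also have "\<dots> = ddiff f (insert l (insert x (set ws)))"
    using dist by (subst ddiff_diff) auto
  also have "insert l (insert x (set ws)) = set (x # y # zs)" unfolding ws by auto
  finally show ?case .
qed (auto simp: ddiff_def)

lemma n_convex_on_ddiff:
  assumes "n_convex_on n I f" "finite X" "X \<subseteq> I" "card X = n + 2"
  shows "0 \<le> ddiff f X"
proof -
  obtain xs where xs: "set xs = X" "distinct xs"
    using finite_distinct_list[OF assms(2)] by auto
  then have "length xs = n + 2" using assms(4) distinct_card[of xs] by simp
  moreover from this have "xs \<noteq> []" by auto
  ultimately show ?thesis
    using assms xs divided_difference_eq_ddiff[of xs f] by (auto simp: n_convex_on_def)
qed

text \<open>By \<open>ddiff_diff\<close> the increment is the displacement times a divided
  difference at n+2 points, which n-convexity makes nonnegative.\<close>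

lemma ddiff_mono_point:
  assumes "n_convex_on n I f" "finite X" "card X = n" "insert x (insert y X) \<subseteq> I"
    and "x \<notin> X" "y \<notin> X" "x \<le> y"
  shows "ddiff f (insert x X) \<le> ddiff f (insert y X)"
proof (cases "x = y")
  case False
  then have "0 \<le> ddiff f (insert x (insert y X))"
    using assms by (intro n_convex_on_ddiff[OF assms(1)]) auto
  then have "ddiff f (insert x X) - ddiff f (insert y X) \<le> 0"
    using assms False by (simp add: ddiff_diff mult_nonpos_nonneg)
  then show ?thesis by simp
qed simp

text \<open>The points of \<open>V\<close> are exchanged for points of \<open>W\<close> one at a
  time; each exchange moves a single point to the right.\<close>

lemma ddiff_mono_set:
  assumes "n_convex_on n I f" "finite V" "finite W" "card V = card W"
    and "finite E" "card E + card V = n + 1" "E \<union> V \<union> W \<subseteq> I"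
    and "E \<inter> (V \<union> W) = {}" "\<And>v w. v \<in> V \<Longrightarrow> w \<in> W \<Longrightarrow> v < w"
  shows "ddiff f (E \<union> V) \<le> ddiff f (E \<union> W)"
  using assms(2-)
proof (induction V arbitrary: E W rule: finite_induct)
  case empty
  then show ?case by simp
next
  case (insert v V)
  have "card W \<noteq> 0" using insert.prems(2) insert.hyps by (metis card_insert_disjoint nat.simps(3))
  then obtain w where "w \<in> W" by fastforce
  moreover define W' where "W' = W - {w}"
  ultimately have W: "W = insert w W'" "w \<notin> W'" "finite W'"
    using insert by auto
  have "v < x" if "x \<in> W" for x using insert.prems(7) that by blast
  then have v: "v \<notin> W" by blast
  \<comment> \<open>The induction hypothesis is used with v counted among the fixed points; v itself
    is exchanged for w afterwards.\<close>
  have "ddiff f (insert v E \<union> V) \<le> ddiff f (insert v E \<union> W')"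
  proof (rule insert.IH)
    show "card V = card W'" using insert W by simp
    show "card (insert v E) + card V = n + 1" using insert by simp
    show "insert v E \<inter> (V \<union> W') = {}" using insert.prems insert.hyps v W by auto
  qed (use insert W in auto)
  also have "\<dots> = ddiff f (insert v (E \<union> W'))" by simp
  also have "\<dots> \<le> ddiff f (insert w (E \<union> W'))"
  proof (rule ddiff_mono_point[OF assms(1)])
    have "E \<inter> W' = {}" using insert.prems W by auto
    then show "card (E \<union> W') = n"
      using insert W by (simp add: card_Un_disjoint)
    show "v \<notin> E \<union> W'" "w \<notin> E \<union> W'" using insert.prems v W by auto
    show "v \<le> w" using insert.prems W by (intro less_imp_le) auto
  qed (use insert W in auto)
  finally show ?case using W by simp
qed

subsection \<open>Orthogonal nodal polynomials\<close>

text \<open>The remainder modulo the nodal polynomial has degree below \<open>card X\<close> and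
  vanishes on \<open>X\<close>, hence is zero.\<close>

lemma nodal_dvd:
  assumes "finite X" "\<And>x. x \<in> X \<Longrightarrow> poly p x = 0"
  shows "nodal X dvd p"
proof (cases "X = {}")
  case False
  have "p mod nodal X = 0"
  proof (rule poly_eqI_degree[of X])
    have "0 < card X" using False assms(1) by (simp add: card_gt_0_iff)
    then show "degree (p mod nodal X) < card X" "degree (0 :: real poly) < card X"
      using degree_mod_less[OF nodal_nonzero, of p X] by (auto simp: degree_nodal)
    show "poly (p mod nodal X) x = poly 0 x" if "x \<in> X" for x
    proof -
      have "poly p x = poly (p div nodal X * nodal X + p mod nodal X) x"
        by (simp only: div_mult_mod_eq)
      also have "\<dots> = poly (p mod nodal X) x"
        using that assms(1) by (simp only: poly_add poly_mult) (simp add: poly_nodal_eq_0_iff)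
      finally show ?thesis using assms(2) that by simp
    qed
  qed
  then show ?thesis by auto
qed (simp add: nodal_def)

text \<open>Gram-Schmidt for the inner product \<open>L (p * q)\<close>. "Degree below k" is
  expressed through vanishing coefficients, so that for k = 0 it singles out the zero
  polynomial.\<close>

lemma orthogonal_projection:
  fixes L :: "real poly \<Rightarrow> real"
  assumes add: "\<And>p q. L (p + q) = L p + L q" and smult: "\<And>c p. L (smult c p) = c * L p"
    and pos: "\<And>p. p \<noteq> 0 \<Longrightarrow> 0 < L (p * p)"
  shows "\<exists>r. (\<forall>i\<ge>k. coeff r i = 0) \<and> (\<forall>q. (\<forall>i\<ge>k. coeff q i = 0) \<longrightarrow> L ((p - r) * q) = 0)"
proof (induction k arbitrary: p)
  case 0
  have "L 0 = 0" using smult[of 0 0] by simp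
  moreover have "q = 0" if "\<forall>i\<ge>0. coeff q i = 0" for q :: "real poly"
    using that by (simp add: poly_eq_iff)
  ultimately show ?case by (metis coeff_0 mult_zero_right)
next
  case (Suc k)
  have diff: "L (u - v) = L u - L v" for u v
    using add[of u "smult (-1) v"] smult[of "-1" v] by simp
  obtain r where r: "\<And>i. k \<le> i \<Longrightarrow> coeff r i = 0"
    "\<And>q. (\<forall>i\<ge>k. coeff q i = 0) \<Longrightarrow> L ((p - r) * q) = 0" using Suc.IH[of p] by blast
  obtain s where s: "\<And>i. k \<le> i \<Longrightarrow> coeff s i = 0"
    "\<And>q. (\<forall>i\<ge>k. coeff q i = 0) \<Longrightarrow> L ((monom 1 k - s) * q) = 0" using Suc.IH[of "monom 1 k"] by blast
  define e where "e = monom 1 k - s"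
  have e: "coeff e k = 1" "\<And>i. k < i \<Longrightarrow> coeff e i = 0" using s(1) by (auto simp: e_def)
  have "e \<noteq> 0" using e(1) by auto
  then have "0 < L (e * e)" by (rule pos)
  \<comment> \<open>The Gram-Schmidt coefficient along e, where e is the monic polynomial of degree
    k orthogonal to all lower degrees.\<close>
  define c where "c = L ((p - r) * e) / L (e * e)"
  show ?case
  proof (intro exI[of _ "r + smult c e"] conjI allI impI)
    show "coeff (r + smult c e) i = 0" if "Suc k \<le> i" for i using that r(1) e(2) by simp
  next
    fix q :: "real poly" assume q: "\<forall>i\<ge>Suc k. coeff q i = 0"
    \<comment> \<open>Split q into its component along e and a rest of degree below k. The rest is
      killed by both induction hypotheses, the component along e by the choice of c.\<close>
    define t q' where "t = coeff q k" and "q' = q - smult t e"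
    have q': "\<forall>i\<ge>k. coeff q' i = 0"
    proof (intro allI impI)
      fix i assume "k \<le> i"
      then show "coeff q' i = 0" using q e by (cases "i = k") (auto simp: q'_def t_def)
    qed
    have "(p - (r + smult c e)) * q = smult t ((p - r) * e) + smult (- (t * c)) (e * e)
        + ((p - r) * q' + smult (- c) (e * q'))"
      by (simp add: q'_def algebra_simps smult_diff_right)
    then have "L ((p - (r + smult c e)) * q) = t * L ((p - r) * e) - t * c * L (e * e)
        + (L ((p - r) * q') - c * L (e * q'))"
      by (simp add: add diff smult)
    then show "L ((p - (r + smult c e)) * q) = 0"
      using r(2)[OF q'] s(2)[OF q'] \<open>0 < L (e * e)\<close> by (simp add: e_def c_def)
  qed
qed

section \<open>Positivity of integrals against the endpoint weight\<close>

lemma integrable_on_poly: "poly (p :: real poly) integrable_on {a..b}"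
  by (intro integrable_continuous_real continuous_intros)

lemma integral_poly_pos:
  fixes p :: "real poly"
  assumes "a < b" "p \<noteq> 0" "\<And>x. x \<in> {a<..<b} \<Longrightarrow> 0 \<le> poly p x"
  shows "0 < integral {a..b} (poly p)"
proof -
  have cont: "continuous_on S (poly p)" for S by (intro continuous_intros)
  have closed: "0 \<le> poly p x" if "x \<in> {a..b}" for x
    using continuous_ge_on_closure[OF cont, where S = "{a<..<b}" and x = x and a = 0] assms(1,3) that
    by (simp add: closure_greaterThanLessThan)
  have "integral {a..b} (poly p) \<noteq> 0"
  proof
    assume "integral {a..b} (poly p) = 0"
    then have "poly p x = 0" if "x \<in> {a..b}" for x
      using integral_eq_0_iff[OF cont _ closed] that assms(1) by simp
    then have "{a..b} \<subseteq> {x. poly p x = 0}" by blast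
    then show False
      using poly_roots_finite[OF assms(2)] assms(1) infinite_Icc finite_subset by blast
  qed
  moreover have "0 \<le> integral {a..b} (poly p)"
    by (intro integral_nonneg integrable_on_poly closed)
  ultimately show ?thesis by simp
qed

text \<open>On [a,b] only the factor x - b can be negative, so for \<open>E\<close> within {a,b}
  this sign turns the product of the x - e into its absolute value. It also records the direction of
  the final inequality: 1 for a lower bound, -1 for an upper bound.\<close>

definition endpoint_sign :: "real \<Rightarrow> real set \<Rightarrow> real" where
  "endpoint_sign b E = (if b \<in> E then -1 else 1)"

lemma endpoint_sign_prod_nonneg:
  assumes "a < b" "E \<subseteq> {a, b}" "x \<in> {a..b}"
  shows "0 \<le> endpoint_sign b E * (\<Prod>e\<in>E. x - e)"
proof -
  consider "E = {}" | "E = {a}" | "E = {b}" | "E = {a, b}" using assms(2) by blast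
  then show ?thesis
  proof cases
    case 4
    have "(x - a) * (x - b) \<le> 0" using assms(3) by (intro mult_nonneg_nonpos) auto
    then show ?thesis using 4 assms(1) by (simp add: endpoint_sign_def)
  qed (use assms(1,3) in \<open>simp_all add: endpoint_sign_def\<close>)
qed

lemma endpoint_sign_square: "endpoint_sign b E * endpoint_sign b E = 1"
  by (simp add: endpoint_sign_def)

lemma endpoint_sign_nonzero: "endpoint_sign b E \<noteq> 0"
  by (simp add: endpoint_sign_def)

text \<open>For \<open>E\<close> within {a,b} this integrates p against the absolute value of the
  nodal polynomial of \<open>E\<close>. Keeping the sign outside leaves a polynomial
  integrand.\<close>

definition endpoint_weighted_integral :: "real \<Rightarrow> real \<Rightarrow> real set \<Rightarrow> real poly \<Rightarrow> real" where
  "endpoint_weighted_integral a b E p =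
    endpoint_sign b E * integral {a..b} (poly (nodal E * p))"

lemma endpoint_weighted_integral_add:
  "endpoint_weighted_integral a b E (p + q) =
    endpoint_weighted_integral a b E p + endpoint_weighted_integral a b E q"
proof -
  have "poly (nodal E * (p + q)) = (\<lambda>x. poly (nodal E * p) x + poly (nodal E * q) x)"
    by (auto simp: algebra_simps)
  then show ?thesis
    by (simp add: endpoint_weighted_integral_def integral_add integrable_on_poly distrib_left del: poly_mult)
qed

lemma endpoint_weighted_integral_smult:
  "endpoint_weighted_integral a b E (smult c p) = c * endpoint_weighted_integral a b E p"
proof -
  have "poly (nodal E * smult c p) = (\<lambda>x. c * poly (nodal E * p) x)" by auto
  then show ?thesis
    by (simp add: endpoint_weighted_integral_def del: poly_mult)
qed

lemma endpoint_weighted_integral_diff: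
  "endpoint_weighted_integral a b E (p - q) =
    endpoint_weighted_integral a b E p - endpoint_weighted_integral a b E q"
  using endpoint_weighted_integral_add[of a b E p "smult (-1) q"]
    endpoint_weighted_integral_smult[of a b E "-1" q] by simp

lemma endpoint_weighted_integral_pos:
  assumes "a < b" "E \<subseteq> {a, b}" "p \<noteq> 0" "\<And>x. x \<in> {a<..<b} \<Longrightarrow> 0 \<le> poly p x"
  shows "0 < endpoint_weighted_integral a b E p"
proof -
  let ?p = "smult (endpoint_sign b E) (nodal E * p)"
  have "0 < integral {a..b} (poly ?p)"
  proof (rule integral_poly_pos[OF assms(1)])
    show "?p \<noteq> 0" using assms(3) nodal_nonzero endpoint_sign_nonzero by simp
    show "0 \<le> poly ?p x" if "x \<in> {a<..<b}" for x
      using endpoint_sign_prod_nonneg[OF assms(1,2), of x] assms(4)[of x] that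
      by (simp add: poly_nodal mult.assoc[symmetric])
  qed
  moreover have "poly ?p = (\<lambda>x. endpoint_sign b E * poly (nodal E * p) x)" by auto
  ultimately show ?thesis by (simp add: endpoint_weighted_integral_def del: poly_mult)
qed

section \<open>Existence and uniqueness of the orthogonal nodes\<close>

lemma orthogonal_poly_no_semidefinite_factor:
  assumes "a < b" "E \<subseteq> {a, b}" "degree (A * B) = k" "A * B \<noteq> 0"
    and orth: "\<And>q. degree q < k \<Longrightarrow> endpoint_weighted_integral a b E (A * B * q) = 0"
    and sign: "(\<forall>x\<in>{a<..<b}. 0 \<le> poly A x) \<or> (\<forall>x\<in>{a<..<b}. poly A x \<le> 0)"
  shows "degree A = 0"
proof (rule ccontr)
  assume "degree A \<noteq> 0"
  then have "degree B < k" using assms(3,4) by (auto simp: degree_mult_eq)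
  obtain c :: real where c: "c \<noteq> 0" "\<forall>x\<in>{a<..<b}. 0 \<le> c * poly A x"
    using sign by (metis mult_1 zero_neq_one mult_minus1 neg_0_le_iff_le neg_equal_0_iff_equal)
  \<comment> \<open>Testing orthogonality against \<open>B\<close> gives A*B*B, which is nonzero
    and, up to the sign c, nonnegative; its weighted integral cannot vanish.\<close>
  have "0 < endpoint_weighted_integral a b E (smult c (A * B * B))"
  proof (rule endpoint_weighted_integral_pos[OF assms(1,2)])
    show "smult c (A * B * B) \<noteq> 0" using c(1) assms(4) by auto
    show "0 \<le> poly (smult c (A * B * B)) x" if "x \<in> {a<..<b}" for x
    proof -
      have "0 \<le> (c * poly A x) * (poly B x * poly B x)"
        by (rule mult_nonneg_nonneg) (use c(2) that in simp_all)
      then show ?thesis by (simp add: mult.assoc)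
    qed
  qed
  then show False using orth[OF \<open>degree B < k\<close>] by (simp add: endpoint_weighted_integral_smult)
qed

text \<open>Split the zeros in the open interval off the monic orthogonal polynomial of degree k.
  The cofactor has no zero there, hence constant sign, so it is constant: the polynomial has k
  simple zeros inside the interval.\<close>

lemma orthogonal_nodes_exist:
  assumes "a < b" "E \<subseteq> {a, b}"
  shows "\<exists>Y\<subseteq>{a<..<b}. finite Y \<and> card Y = k \<and>
    (\<forall>q. degree q < k \<longrightarrow> endpoint_weighted_integral a b E (nodal Y * q) = 0)"
proof -
  let ?L = "endpoint_weighted_integral a b E"
  have "0 < ?L (p * p)" if "p \<noteq> 0" for p
    using that by (intro endpoint_weighted_integral_pos assms) auto
  then obtain r where r: "\<And>i. k \<le> i \<Longrightarrow> coeff r i = 0"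
    "\<And>q. (\<forall>i\<ge>k. coeff q i = 0) \<Longrightarrow> ?L ((monom 1 k - r) * q) = 0"
    using orthogonal_projection[of ?L k "monom 1 k", OF endpoint_weighted_integral_add
        endpoint_weighted_integral_smult] by metis
  define P where "P = monom 1 k - r"
  have deg: "degree P = k"
  proof (rule antisym)
    show "degree P \<le> k" using r(1) by (intro degree_le) (auto simp: P_def)
    show "k \<le> degree P" using r(1) by (intro le_degree) (auto simp: P_def)
  qed
  have lead: "coeff P k = 1" using r(1) by (simp add: P_def)
  then have "P \<noteq> 0" by auto
  have orth: "?L (P * q) = 0" if "degree q < k" for q
    unfolding P_def using that by (intro r(2) allI impI coeff_eq_0) simp
  define Y where "Y = {x \<in> {a<..<b}. poly P x = 0}"
  have "finite Y" using poly_roots_finite[OF \<open>P \<noteq> 0\<close>] by (auto simp: Y_def intro: finite_subset)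
  have "nodal Y dvd P"
    using \<open>finite Y\<close> by (intro nodal_dvd) (auto simp: Y_def)
  then obtain A where "P = nodal Y * A" by (rule dvdE)
  then have A: "P = A * nodal Y" by (simp only: mult.commute)
  \<comment> \<open>A zero of the cofactor would already lie in \<open>Y\<close>, hence be a double
    zero of \<open>P\<close>; the resulting square factor is semidefinite and not constant.\<close>
  have A0: "poly A x \<noteq> 0" if x: "x \<in> {a<..<b}" for x
  proof
    assume Ax: "poly A x = 0"
    then have "poly P x = 0" by (simp add: A)
    then have "x \<in> Y" using x by (simp add: Y_def)
    obtain A' where A': "A = [:- x, 1:] * A'" using Ax unfolding poly_eq_0_iff_dvd by (rule dvdE)
    have "nodal Y = [:- x, 1:] * nodal (Y - {x})"
      unfolding nodal_def by (rule prod.remove[OF \<open>finite Y\<close> \<open>x \<in> Y\<close>])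
    then have P: "P = ([:- x, 1:] * [:- x, 1:]) * (A' * nodal (Y - {x}))"
      unfolding A A' by (simp only: ac_simps)
    have "degree ([:- x, 1:] * [:- x, 1:]) = 0"
    proof (rule orthogonal_poly_no_semidefinite_factor[OF assms
          deg[unfolded P] \<open>P \<noteq> 0\<close>[unfolded P] orth[unfolded P]])
      show "(\<forall>y\<in>{a<..<b}. 0 \<le> poly ([:- x, 1:] * [:- x, 1:]) y) \<or>
          (\<forall>y\<in>{a<..<b}. poly ([:- x, 1:] * [:- x, 1:]) y \<le> 0)"
        by (intro disjI1 ballI) (simp only: poly_mult zero_le_square)
    qed
    then show False by simp
  qed
  have sign: "(\<forall>x\<in>{a<..<b}. 0 \<le> poly A x) \<or> (\<forall>x\<in>{a<..<b}. poly A x \<le> 0)"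
  proof (rule ccontr)
    assume "\<not> ?thesis"
    then obtain x y where xy: "x \<in> {a<..<b}" "poly A x < 0" "y \<in> {a<..<b}" "0 < poly A y"
      by (auto simp: not_le)
    then have "x < y \<or> y < x" by (cases x y rule: linorder_cases) auto
    then obtain z where "min x y < z" "z < max x y" "poly A z = 0"
    proof
      assume "x < y"
      then show thesis using poly_IVT_pos[of x y A] xy that by auto
    next
      assume "y < x"
      then show thesis using poly_IVT_neg[of y x A] xy that by auto
    qed
    moreover have "z \<in> {a<..<b}" using calculation xy by auto
    ultimately show False using A0 by blast
  qed
  have "degree A = 0"
    by (rule orthogonal_poly_no_semidefinite_factor[OF assms
          deg[unfolded A] \<open>P \<noteq> 0\<close>[unfolded A] orth[unfolded A] sign])
  then obtain c where "A = [:c:]" by (meson degree_eq_zeroE)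
  then have P: "P = smult c (nodal Y)" by (simp add: A)
  then have "c \<noteq> 0" using \<open>P \<noteq> 0\<close> by auto
  show ?thesis
  proof (intro exI[of _ Y] conjI allI impI)
    show "card Y = k" using P deg \<open>c \<noteq> 0\<close> by (simp add: degree_nodal)
    show "?L (nodal Y * q) = 0" if "degree q < k" for q
      using orth[OF that] \<open>c \<noteq> 0\<close> P by (simp add: endpoint_weighted_integral_smult)
  qed (use \<open>finite Y\<close> in \<open>auto simp: Y_def\<close>)
qed

text \<open>Both nodal polynomials are monic of degree k, so their difference has lower degree. It
  is therefore orthogonal to itself and must be zero.\<close>

lemma orthogonal_nodes_unique:
  assumes "a < b" "E \<subseteq> {a, b}" "finite Y" "finite Z" "card Y = k" "card Z = k"
    and "\<And>q. degree q < k \<Longrightarrow> endpoint_weighted_integral a b E (nodal Y * q) = 0"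
    and "\<And>q. degree q < k \<Longrightarrow> endpoint_weighted_integral a b E (nodal Z * q) = 0"
  shows "Y = Z"
proof -
  define d where "d = nodal Y - nodal Z"
  have "d = 0"
  proof (rule ccontr)
    assume "d \<noteq> 0"
    have "coeff d i = 0" if "k \<le> i" for i
    proof (cases "i = k")
      case True
      then show ?thesis
        using monic_nodal[of Y] monic_nodal[of Z] by (simp add: d_def degree_nodal assms(5,6))
    next
      case False
      then have "coeff (nodal Y) i = 0" "coeff (nodal Z) i = 0"
        using that by (auto intro: coeff_eq_0 simp: degree_nodal assms(5,6))
      then show ?thesis by (simp add: d_def)
    qed
    then have "degree d < k" using \<open>d \<noteq> 0\<close> by (meson leading_coeff_0_iff not_le)
    have "d * d = nodal Y * d - nodal Z * d" by (simp add: d_def left_diff_distrib)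
    then have "endpoint_weighted_integral a b E (d * d) = 0"
      using assms(7,8)[OF \<open>degree d < k\<close>] by (simp add: endpoint_weighted_integral_diff)
    moreover have "0 < endpoint_weighted_integral a b E (d * d)"
      using \<open>d \<noteq> 0\<close> by (intro endpoint_weighted_integral_pos assms) auto
    ultimately show False by simp
  qed
  then have "poly (nodal Y) x = poly (nodal Z) x" for x by (simp add: d_def)
  then show ?thesis
    using poly_nodal_eq_0_iff[OF assms(3)] poly_nodal_eq_0_iff[OF assms(4)] by auto
qed

subsection \<open>Quadratures with prescribed endpoints\<close>

lemma integral_eq_endpoint_weighted_integral:
  "integral {a..b} (poly (nodal E * p)) = endpoint_sign b E * endpoint_weighted_integral a b E p"
  by (simp add: endpoint_weighted_integral_def mult.assoc[symmetric] endpoint_sign_square)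

lemma integral_poly_add:
  fixes p q :: "real poly"
  shows "integral {a..b} (poly (p + q)) = integral {a..b} (poly p) + integral {a..b} (poly q)"
proof -
  have "poly (p + q) = (\<lambda>x. poly p x + poly q x)" by auto
  then show ?thesis by (simp add: integral_add integrable_on_poly)
qed

lemma integral_interpolant:
  assumes "finite X"
  shows "integral {a..b} (poly (interpolant f X)) =
    (\<Sum>x\<in>X. f x * integral {a..b} (poly (lagrange_basis X x)))"
proof -
  have "poly (interpolant f X) = (\<lambda>t. \<Sum>x\<in>X. f x * poly (lagrange_basis X x) t)"
    by (auto simp: interpolant_def poly_sum)
  then show ?thesis
    using assms by (simp add: integral_sum integrable_on_poly integrable_on_mult_right)
qed

text \<open>One treatment of all four rules: \<open>E\<close> is {} for Gauss, {a,b} for Lobatto,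
  {a} or {b} for Radau. The rule is the interpolatory one on \<open>E\<close> and the orthogonal
  nodes.\<close>

lemma gauss_type_quadrature:
  assumes "a < b" "E \<subseteq> {a, b}" "n + 1 = 2 * k + card E"
  obtains Y \<alpha> where "finite Y" "Y \<subseteq> {a<..<b}" "card Y = k"
    and "exact_up_to_degree a b n (\<lambda>f. \<Sum>x\<in>E \<union> Y. \<alpha> x * f x)"
    and "(THE Q. \<exists>X. quadrature_with_nodes a b (card E + k) X Q \<and> E \<subseteq> X \<and>
           exact_up_to_degree a b n Q) = (\<lambda>f. \<Sum>x\<in>E \<union> Y. \<alpha> x * f x)"
proof -
  obtain Y where Y: "Y \<subseteq> {a<..<b}" "finite Y" "card Y = k"
    and orth: "\<And>q. degree q < k \<Longrightarrow> endpoint_weighted_integral a b E (nodal Y * q) = 0"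
    using orthogonal_nodes_exist[OF assms(1,2)] by metis
  have E: "finite E" using assms(2) by (rule finite_subset) simp
  have "{a, b} \<inter> {a<..<b} = {}" by auto
  then have disj: "E \<inter> Y = {}" using Y(1) assms(2) by blast
  define X where "X = E \<union> Y"
  have X: "finite X" "card X = card E + k"
    using E Y disj by (simp_all add: X_def card_Un_disjoint)
  define \<alpha> where "\<alpha> x = 1 / (b - a) * integral {a..b} (poly (lagrange_basis X x))" for x
  define Q where "Q = (\<lambda>f. \<Sum>x\<in>X. \<alpha> x * f x)"
  have Q_interpolant: "Q f = 1 / (b - a) * integral {a..b} (poly (interpolant f X))" for f
    using X(1) by (simp add: Q_def \<alpha>_def integral_interpolant sum_distrib_left ac_simps)
  have "0 < card X" using assms(3) X(2) by linarith
  have exact: "exact_up_to_degree a b n Q"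
    unfolding exact_up_to_degree_def
  proof (intro allI impI)
    fix p :: "real poly" assume deg: "degree p \<le> n"
    \<comment> \<open>The degree count makes the quotient q orthogonal to the nodal polynomial of
      \<open>Y\<close>, so the first summand has integral zero; it also vanishes at the nodes. The
      remainder is reproduced by interpolation.\<close>
    define q r where "q = p div nodal X" and "r = p mod nodal X"
    have p: "p = nodal X * q + r" by (simp add: q_def r_def)
    have r: "degree r < card X"
      using degree_mod_less[OF nodal_nonzero, of p X] \<open>0 < card X\<close> by (auto simp: r_def degree_nodal)
    have "endpoint_weighted_integral a b E (nodal Y * q) = 0"
    \<comment> \<open>For k = 0 the quotient is zero and does not satisfy
      \<open>degree q < k\<close>, so this case bypasses orthogonality.\<close>
    proof (cases "q = 0")
      case False
      then have nq: "degree (nodal X * q) = card X + degree q"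
        by (simp add: degree_mult_eq nodal_nonzero degree_nodal)
      then have "degree p = card X + degree q"
        using r unfolding p by (simp add: degree_add_eq_left)
      then show ?thesis using deg assms(3) X(2) by (intro orth) linarith
    qed (use endpoint_weighted_integral_smult[of a b E 0 0] in simp)
    then have "integral {a..b} (poly (nodal X * q)) = 0"
      using integral_eq_endpoint_weighted_integral[of a b E "nodal Y * q"]
      by (simp add: X_def nodal_Un[OF E Y(2) disj] mult.assoc del: poly_mult)
    then have "integral {a..b} (poly p) = integral {a..b} (poly r)"
      unfolding p by (subst integral_poly_add) simp
    moreover have "Q (poly p) = Q (poly r)"
      unfolding Q_def p by (rule sum.cong) (use X(1) in \<open>auto simp: poly_nodal_eq_0_iff\<close>)
    ultimately show "Q (poly p) = 1 / (b - a) * integral {a..b} (poly p)"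
      by (simp add: Q_interpolant interpolant_poly[OF X(1) r])
  qed
  have unique: "Q' = Q" if quad: "quadrature_with_nodes a b (card E + k) X' Q'" and "E \<subseteq> X'"
    and ex: "exact_up_to_degree a b n Q'" for X' Q'
  proof -
    obtain \<beta> where X': "finite X'" "card X' = card E + k" and Q': "Q' = (\<lambda>f. \<Sum>x\<in>X'. \<beta> x * f x)"
      using quad unfolding quadrature_with_nodes_def by blast
    have eX': "Q' (poly p) = 1 / (b - a) * integral {a..b} (poly p)" if "degree p \<le> n" for p
      using ex that by (simp add: exact_up_to_degree_def)
    define Z where "Z = X' - E"
    have Z: "finite Z" "card Z = k" "E \<inter> Z = {}" "E \<union> Z = X'"
      using X' E \<open>E \<subseteq> X'\<close> by (auto simp: Z_def card_Diff_subset)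
    \<comment> \<open>The nodal polynomial of \<open>X'\<close> times q vanishes at every node and
      has degree at most n, so exactness forces its integral to be zero.\<close>
    have "endpoint_weighted_integral a b E (nodal Z * q) = 0" if "degree q < k" for q
    proof -
      have NX: "nodal E * (nodal Z * q) = nodal X' * q"
        using nodal_Un[OF E Z(1,3)] Z(4) by (simp add: mult.assoc)
      have "degree (nodal X' * q) \<le> card X' + degree q"
        using degree_mult_le[of "nodal X'" q] by (simp add: degree_nodal)
      then have deg: "degree (nodal X' * q) \<le> n" using that assms(3) X'(2) by linarith
      have "Q' (poly (nodal X' * q)) = 0"
        unfolding Q' using X'(1) by (intro sum.neutral) (auto simp: poly_nodal_eq_0_iff)
      then have "integral {a..b} (poly (nodal X' * q)) = 0"
        using assms(1) eX'[OF deg] by (simp del: poly_mult)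
      then show ?thesis by (simp add: endpoint_weighted_integral_def NX del: poly_mult)
    qed
    from orthogonal_nodes_unique[OF assms(1,2) Y(2) Z(1) Y(3) Z(2) orth this]
    have "X' = X" using Z(4) by (simp add: X_def)
    \<comment> \<open>Exactness on the Lagrange basis polynomials reads off the weights.\<close>
    have "\<beta> x = \<alpha> x" if "x \<in> X" for x
    proof -
      have "degree (lagrange_basis X x) \<le> n"
        using degree_lagrange_basis[OF X(1) that] X(2) assms(3) by linarith
      from eX'[OF this] have "(\<Sum>z\<in>X. \<beta> z * poly (lagrange_basis X x) z) = \<alpha> x"
        unfolding Q' \<open>X' = X\<close> \<alpha>_def .
      moreover have "(\<Sum>z\<in>X. \<beta> z * poly (lagrange_basis X x) z) = (\<Sum>z\<in>X. if z = x then \<beta> z else 0)"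
        using X(1) that by (intro sum.cong) (auto simp: poly_lagrange_basis)
      ultimately show ?thesis using X(1) that by simp
    qed
    then show ?thesis
      unfolding Q' Q_def \<open>X' = X\<close> by (intro ext sum.cong) auto
  qed
  have "quadrature_with_nodes a b (card E + k) X Q"
    using X Y(1) assms(1,2) by (auto simp: quadrature_with_nodes_def Q_def X_def)
  moreover have "E \<subseteq> X" by (simp add: X_def)
  ultimately have "(THE Q. \<exists>X. quadrature_with_nodes a b (card E + k) X Q \<and> E \<subseteq> X \<and>
      exact_up_to_degree a b n Q) = Q"
    using exact by (intro the_equality exI[of _ X]) (auto intro: unique)
  then show ?thesis
    using that[OF Y(2,1,3), of \<alpha>] exact by (simp add: Q_def X_def)
qed

subsection \<open>Interpolation of n-convex functions\<close>

lemma abs_prod_diff_le: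
  fixes x :: real
  assumes "x \<in> {a..b}" "Z \<subseteq> {a..b}"
  shows "\<bar>\<Prod>z\<in>Z. x - z\<bar> \<le> (b - a) ^ card Z"
proof -
  have "\<bar>x - z\<bar> \<le> b - a" if "z \<in> Z" for z using that assms by force
  then have "(\<Prod>z\<in>Z. \<bar>x - z\<bar>) \<le> (\<Prod>z\<in>Z. b - a)" by (intro prod_mono) auto
  then show ?thesis by (simp add: abs_prod)
qed

lemma obtain_subset_of_open_interval:
  fixes a b :: real
  assumes "a < b"
  obtains V where "V \<subseteq> {a<..<b}" "finite V" "card V = m"
  using infinite_arbitrarily_large[OF infinite_Ioo[OF assms], of m] by blast

text \<open>Interpolation at n interior points leaves a monotone divided difference as the
  coefficient of the nodal product. This gives measurability and boundedness without any continuity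
  of f. The value 0 on \<open>Z\<close> is harmless because the product vanishes there.\<close>

lemma n_convex_on_representation:
  assumes "a < b" "n_convex_on n {a..b} f"
  obtains p g Z where "finite Z" "a \<notin> Z" "b \<notin> Z" "Z \<subseteq> {a..b}"
    and "mono_on ({a..b} - Z) g"
    and "\<And>x. x \<in> {a..b} \<Longrightarrow> f x = poly p x + (if x \<in> Z then 0 else g x) * (\<Prod>z\<in>Z. x - z)"
proof -
  obtain Z where Z: "Z \<subseteq> {a<..<b}" "finite Z" "card Z = n"
    using obtain_subset_of_open_interval[OF assms(1)] .
  show ?thesis
  proof (rule that[of Z "\<lambda>x. ddiff f (insert x Z)" "interpolant f Z"])
    show "mono_on ({a..b} - Z) (\<lambda>x. ddiff f (insert x Z))"
      using Z by (intro mono_onI ddiff_mono_point[OF assms(2)]) auto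
    show "f x = poly (interpolant f Z) x + (if x \<in> Z then 0 else ddiff f (insert x Z)) * (\<Prod>z\<in>Z. x - z)" for x
    proof (cases "x \<in> Z")
      case False
      then show ?thesis using interpolant_remainder[OF Z(2) False, of f] by simp
    qed (simp add: poly_interpolant Z(2))
  qed (use Z in auto)
qed

section \<open>Measurability and boundedness of n-convex functions\<close>

lemma n_convex_on_measurable:
  assumes "a < b" "n_convex_on n {a..b} f"
  shows "f \<in> borel_measurable (restrict_space borel {a..b})"
proof -
  obtain p g Z where Z: "finite Z" and mono: "mono_on ({a..b} - Z) g"
    and f: "\<And>x. x \<in> {a..b} \<Longrightarrow> f x = poly p x + (if x \<in> Z then 0 else g x) * (\<Prod>z\<in>Z. x - z)"
    using n_convex_on_representation[OF assms] by metis
  let ?M = "restrict_space borel {a..b}"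
  have Zs: "Z \<in> sets borel" using Z by (intro borel_closed finite_imp_closed)
  have "g \<in> borel_measurable (restrict_space borel ({a..b} - Z))"
    using mono by (rule borel_measurable_mono_on_fnc)
  then have "g \<in> borel_measurable (restrict_space ?M {x. x \<notin> Z})"
    using Zs by (subst restrict_restrict_space) (auto simp: Diff_eq Collect_neg_eq)
  moreover have "{x \<in> space ?M. x \<in> Z} \<in> sets ?M"
    using Zs by (auto simp: sets_restrict_space space_restrict_space)
  ultimately have "(\<lambda>x. if x \<in> Z then 0 else g x) \<in> borel_measurable ?M"
    by (subst measurable_If_restrict_space_iff) auto
  moreover have "poly q \<in> borel_measurable ?M" for q
    by (intro measurable_restrict_space1 borel_measurable_continuous_onI continuous_intros)
  moreover have "(\<lambda>x. \<Prod>z\<in>Z. x - z) \<in> borel_measurable ?M"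
    using calculation(2)[of "nodal Z"] by (simp add: poly_nodal[abs_def])
  ultimately have "(\<lambda>x. poly p x + (if x \<in> Z then 0 else g x) * (\<Prod>z\<in>Z. x - z)) \<in> borel_measurable ?M"
    by (intro borel_measurable_add borel_measurable_times)
  then show ?thesis
    using f by (subst measurable_cong[where g = "\<lambda>x. poly p x + (if x \<in> Z then 0 else g x) * (\<Prod>z\<in>Z. x - z)"])
      (auto simp: space_restrict_space)
qed

lemma poly_bounded_on_interval:
  fixes p :: "real poly"
  obtains M where "\<And>x. x \<in> {a..b} \<Longrightarrow> \<bar>poly p x\<bar> \<le> M"
proof -
  have "bounded (poly p ` {a..b})"
    by (intro compact_imp_bounded compact_continuous_image continuous_intros) auto
  then obtain M where "\<forall>y\<in>poly p ` {a..b}. norm y \<le> M" unfolding bounded_iff by blast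
  then show ?thesis by (intro that[of M]) auto
qed

lemma n_convex_on_bounded:
  assumes "a < b" "n_convex_on n {a..b} f"
  obtains B where "\<And>x. x \<in> {a..b} \<Longrightarrow> \<bar>f x\<bar> \<le> B"
proof -
  obtain p g Z where Z: "finite Z" "a \<notin> Z" "b \<notin> Z" "Z \<subseteq> {a..b}" and mono: "mono_on ({a..b} - Z) g"
    and f: "\<And>x. x \<in> {a..b} \<Longrightarrow> f x = poly p x + (if x \<in> Z then 0 else g x) * (\<Prod>z\<in>Z. x - z)"
    using n_convex_on_representation[OF assms] by metis
  obtain M where M: "\<And>x. x \<in> {a..b} \<Longrightarrow> \<bar>poly p x\<bar> \<le> M"
    using poly_bounded_on_interval[where p = p and a = a and b = b] by blast
  define G where "G = \<bar>g a\<bar> + \<bar>g b\<bar>"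
  show ?thesis
  proof (rule that)
    fix x assume x: "x \<in> {a..b}"
    \<comment> \<open>Neither endpoint lies in \<open>Z\<close>, so monotonicity encloses g between
      its values at a and b.\<close>
    have "\<bar>if x \<in> Z then 0 else g x\<bar> \<le> G"
    proof (cases "x \<in> Z")
      case False
      then have "g a \<le> g x" "g x \<le> g b" using x Z assms(1) by (auto intro!: mono_onD[OF mono])
      then show ?thesis using False by (simp add: G_def)
    qed (simp add: G_def)
    then have "\<bar>(if x \<in> Z then 0 else g x) * (\<Prod>z\<in>Z. x - z)\<bar> \<le> G * (b - a) ^ card Z"
      unfolding abs_mult by (intro mult_mono abs_prod_diff_le x Z) (auto simp: G_def)
    then show "\<bar>f x\<bar> \<le> M + G * (b - a) ^ card Z"
      unfolding f[OF x] using M[OF x] by linarith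
  qed
qed

section \<open>Interpolation at pairs of nearby nodes\<close>

lemma finite_set_gap:
  fixes A :: "real set"
  assumes "finite A"
  obtains h where "0 < h" "\<And>y z. y \<in> A \<Longrightarrow> z \<in> A \<Longrightarrow> y < z \<Longrightarrow> y + h \<le> z"
proof -
  \<comment> \<open>The element 1 keeps the set nonempty when there are no two distinct
    points.\<close>
  define T where "T = insert 1 ((\<lambda>(y, z). z - y) ` (A \<times> A) \<inter> {0<..})"
  have T: "finite T" "T \<noteq> {}" using assms by (simp_all add: T_def)
  show ?thesis
  proof (rule that[of "Min T"])
    show "0 < Min T" using T by (subst Min_gr_iff) (auto simp: T_def)
    show "y + Min T \<le> z" if "y \<in> A" "z \<in> A" "y < z" for y z
    proof -
      have "z - y \<in> T" using that by (auto simp: T_def)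
      then have "Min T \<le> z - y" using T by simp
      then show ?thesis by simp
    qed
  qed
qed

lemma finite_subset_open_interval_margins:
  fixes a b :: real
  assumes "a < b" "finite Y" "Y \<subseteq> {a<..<b}"
  obtains c d where "a < c" "d < b" "a < d" "c < b" "\<And>y. y \<in> Y \<Longrightarrow> c < y \<and> y < d"
proof -
  \<comment> \<open>Inserting an endpoint covers empty \<open>Y\<close> and also yields c < b and a
    < d.\<close>
  have "a < Min (insert b Y)" "Max (insert a Y) < b" using assms by auto
  then obtain c d where "a < c" "c < Min (insert b Y)" "Max (insert a Y) < d" "d < b"
    using dense by meson
  then show ?thesis using assms(2) by (intro that[of c d]) auto
qed

lemma n_convex_on_near_osculation:
  assumes "a < b" "E \<subseteq> {a, b}" "n + 1 = 2 * k + card E"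
    and Y: "finite Y" "Y \<subseteq> {a<..<b}" "card Y = k"
    and f: "n_convex_on n {a..b} f"
  obtains C h0 where "0 < h0"
    and "\<And>h. 0 < h \<Longrightarrow> h < h0 \<Longrightarrow> \<exists>p. degree p \<le> n \<and> (\<forall>x\<in>E \<union> Y. poly p x = f x) \<and>
           (\<forall>x\<in>{a..b}. - (C * h) \<le> endpoint_sign b E * (f x - poly p x))"
proof -
  obtain c d where cd: "a < c" "d < b" "a < d" "c < b" and Ycd: "\<And>y. y \<in> Y \<Longrightarrow> c < y \<and> y < d"
    using finite_subset_open_interval_margins[OF assms(1) Y(1,2)] by metis
  \<comment> \<open>Including d in the gap condition ensures that for h below h0 the shifted nodes
    avoid \<open>Y\<close> and also stay below d.\<close>
  obtain h0 where h0: "0 < h0"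
    and gap: "\<And>y z. y \<in> insert d Y \<Longrightarrow> z \<in> insert d Y \<Longrightarrow> y < z \<Longrightarrow> y + h0 \<le> z"
    using finite_set_gap[of "insert d Y"] Y(1) by blast
  \<comment> \<open>All movable nodes will lie in [c,d], hence to the right of \<open>V\<close> and
    to the left of \<open>V'\<close>. Monotonicity then bounds their divided differences by a
    constant independent of h.\<close>
  obtain V where V: "V \<subseteq> {a<..<c}" "finite V" "card V = 2 * k"
    using obtain_subset_of_open_interval[OF cd(1)] .
  obtain V' where V': "V' \<subseteq> {d<..<b}" "finite V'" "card V' = 2 * k"
    using obtain_subset_of_open_interval[OF cd(2)] .
  have E: "finite E" "E \<subseteq> {a..b}" "E \<inter> {a<..<b} = {}"
    using assms(1,2) finite_subset[OF assms(2)] by auto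
  define B where "B = \<bar>ddiff f (E \<union> V)\<bar> + \<bar>ddiff f (E \<union> V')\<bar>"
  have B: "\<bar>ddiff f (E \<union> W)\<bar> \<le> B" if W: "finite W" "card W = 2 * k" "W \<subseteq> {c..d}" for W
  proof -
    have sub: "W \<subseteq> {a<..<b}" "V \<subseteq> {a<..<b}" "V' \<subseteq> {a<..<b}"
      using W(3) V(1) V'(1) cd by fastforce+
    then have sub': "E \<union> V \<union> W \<subseteq> {a..b}" "E \<union> W \<union> V' \<subseteq> {a..b}" "E \<inter> (V \<union> W) = {}" "E \<inter> (W \<union> V') = {}"
      using E greaterThanLessThan_subseteq_atLeastAtMost_iff[of a b a b] by blast+
    have "ddiff f (E \<union> V) \<le> ddiff f (E \<union> W)"
    proof (rule ddiff_mono_set[OF f V(2) W(1) _ E(1) _ sub'(1,3)])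
      show "v < w" if "v \<in> V" "w \<in> W" for v w using that V(1) W(3) by fastforce
    qed (use assms(3) V W in auto)
    moreover have "ddiff f (E \<union> W) \<le> ddiff f (E \<union> V')"
    proof (rule ddiff_mono_set[OF f W(1) V'(2) _ E(1) _ sub'(2,4)])
      show "v < w" if "v \<in> W" "w \<in> V'" for v w using that V'(1) W(3) by fastforce
    qed (use assms(3) V' W in auto)
    ultimately show ?thesis by (simp add: B_def)
  qed
  \<comment> \<open>2B bounds the difference of two divided differences of order n; n-1 counts the
    nodes left after removing y and y+h. It is needed only when \<open>Y\<close> is nonempty, so
    that n is at least 1.\<close>
  define C where "C = 2 * B * (b - a) ^ (n - 1)"
  have "0 \<le> B" by (simp add: B_def)
  then have "0 \<le> C" using assms(1) by (simp add: C_def)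
  have main: "\<exists>p. degree p \<le> n \<and> (\<forall>x\<in>E \<union> Y. poly p x = f x) \<and>
           (\<forall>x\<in>{a..b}. - (C * h) \<le> endpoint_sign b E * (f x - poly p x))" if h: "0 < h" "h < h0" for h
  proof -
    define Yh where "Yh = (\<lambda>y. y + h) ` Y"
    define W where "W = Y \<union> Yh"
    have Yh: "finite Yh" "card Yh = k" using Y by (auto simp: Yh_def card_image)
    have shift: "y + h \<notin> Y \<and> c < y + h \<and> y + h < d" if "y \<in> Y" for y
    proof -
      have "y + h \<notin> Y"
      proof
        assume "y + h \<in> Y"
        then show False using gap[of y "y + h"] that h by simp
      qed
      moreover have "y + h0 \<le> d" using gap[of y d] Ycd[OF that] that by simp
      ultimately show ?thesis using Ycd[OF that] h by linarith
    qed
    then have "Y \<inter> Yh = {}" by (auto simp: Yh_def)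
    then have W: "finite W" "card W = 2 * k" using Y Yh by (simp_all add: W_def card_Un_disjoint)
    have Wcd: "W \<subseteq> {c..d}"
      using Ycd shift by (fastforce simp: W_def Yh_def)
    then have "W \<subseteq> {a<..<b}" using cd by fastforce
    then have EW: "E \<inter> W = {}" "E \<union> W \<subseteq> {a..b}" using E by force+
    define Z where "Z = E \<union> W"
    have Z: "finite Z" "card Z = n + 1" "Z \<subseteq> {a..b}"
      using E(1) W EW assms(3) by (simp_all add: Z_def card_Un_disjoint)
    define p where "p = interpolant f Z"
    have sign: "\<bar>endpoint_sign b E\<bar> = 1" by (simp add: endpoint_sign_def)
    have "- (C * h) \<le> endpoint_sign b E * (f x - poly p x)" if x: "x \<in> {a..b}" for x
    proof (cases "x \<in> Z")
      case True
      then show ?thesis using Z(1) \<open>0 \<le> C\<close> h by (simp add: p_def poly_interpolant)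
    next
      case False
      have rem: "f x - poly p x = ddiff f (insert x Z) * (\<Prod>z\<in>Z. x - z)"
        unfolding p_def by (rule interpolant_remainder[OF Z(1) False])
      show ?thesis
      proof (cases "\<exists>y\<in>Y. y < x \<and> x < y + h")
        case True
        then obtain y where y: "y \<in> Y" "y < x" "x < y + h" by blast
        \<comment> \<open>The divided difference at n+2 points may be large, but times x - u it is a
          difference of two of order n, each bounded by \<open>B\<close>. The factor x - y then
          contributes the h.\<close>
        define u where "u = y + h"
        define W0 where "W0 = W - {u}"
        have uW: "u \<in> W" "u \<notin> E" using y EW by (auto simp: W_def Yh_def u_def)
        have xcd: "x \<in> {c..d}" "x \<notin> E \<union> W" "x \<noteq> u"
          using y Ycd[OF y(1)] shift[OF y(1)] False by (auto simp: Z_def u_def)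
        have Zu: "Z = insert u (E \<union> W0)" "u \<notin> E \<union> W0" using uW by (auto simp: Z_def W0_def)
        have W0: "finite W0" "card W0 = 2 * k - 1" using W uW by (auto simp: W0_def)
        have "0 < card W" using uW(1) W(1) by (auto simp: card_gt_0_iff)
        have "card (insert x W0) = 2 * k"
          using W0 xcd W \<open>0 < card W\<close> by (simp add: W0_def)
        then have "\<bar>ddiff f (E \<union> insert x W0)\<bar> \<le> B"
          using W0 xcd Wcd by (intro B) (auto simp: W0_def)
        moreover have "\<bar>ddiff f (E \<union> W)\<bar> \<le> B" by (intro B W Wcd)
        moreover have "ddiff f (insert x (E \<union> W0)) - ddiff f (insert u (E \<union> W0))
            = (x - u) * ddiff f (insert x (insert u (E \<union> W0)))"
          using E(1) W0 xcd Zu by (intro ddiff_diff) (auto simp: W0_def)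
        then have "(x - u) * ddiff f (insert x Z) = ddiff f (E \<union> insert x W0) - ddiff f (E \<union> W)"
          using Zu(1) by (simp add: Z_def)
        ultimately have D: "\<bar>(x - u) * ddiff f (insert x Z)\<bar> \<le> 2 * B" by linarith
        have yZ: "y \<in> Z - {u}" using y h by (auto simp: Z_def W_def u_def)
        have "(\<Prod>z\<in>Z. x - z) = (x - u) * ((x - y) * (\<Prod>z\<in>Z - {u} - {y}. x - z))"
          using Z(1) uW yZ by (subst prod.remove[of Z u]; simp add: Z_def)
            (subst prod.remove[of _ y]; simp)
        then have "f x - poly p x = ((x - u) * ddiff f (insert x Z)) * ((x - y) * (\<Prod>z\<in>Z - {u} - {y}. x - z))"
          by (simp add: rem)
        then have "\<bar>f x - poly p x\<bar> = \<bar>(x - u) * ddiff f (insert x Z)\<bar> * (\<bar>x - y\<bar> * \<bar>\<Prod>z\<in>Z - {u} - {y}. x - z\<bar>)"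
          by (simp only: abs_mult)
        also have "\<dots> \<le> 2 * B * (h * (b - a) ^ card (Z - {u} - {y}))"
          using y assms(1) h Z(3) \<open>0 \<le> B\<close>
          by (intro mult_mono D abs_prod_diff_le x) auto
        also have "card (Z - {u} - {y}) = n - 1"
          using Z uW yZ by (simp add: Z_def card_Diff_singleton)
        finally have "\<bar>f x - poly p x\<bar> \<le> C * h" by (simp add: C_def mult_ac)
        then have "\<bar>endpoint_sign b E * (f x - poly p x)\<bar> \<le> C * h" by (simp add: abs_mult sign)
        then show ?thesis by linarith
      next
        case no: False
        \<comment> \<open>Outside the short intervals each pair (x-y)(x-(y+h)) is nonnegative, so
          the sign of the remainder is decided by \<open>E\<close> alone.\<close>
        have "0 \<le> ddiff f (insert x Z)"
          using Z x False by (intro n_convex_on_ddiff[OF f]) auto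
        moreover have "(\<Prod>z\<in>Z. x - z) = (\<Prod>e\<in>E. x - e) * (\<Prod>y\<in>Y. (x - y) * (x - (y + h)))"
          using E(1) W(1) EW(1) Y(1) Yh(1) \<open>Y \<inter> Yh = {}\<close>
          by (simp add: Z_def W_def prod.union_disjoint prod.distrib) (simp add: Yh_def prod.reindex)
        moreover have "0 \<le> (\<Prod>y\<in>Y. (x - y) * (x - (y + h)))"
        proof (rule prod_nonneg)
          fix y assume "y \<in> Y"
          then have "x \<le> y \<or> y + h \<le> x" using no by force
          then show "0 \<le> (x - y) * (x - (y + h))"
            using h by (auto intro: mult_nonpos_nonpos mult_nonneg_nonneg)
        qed
        moreover have "0 \<le> endpoint_sign b E * (\<Prod>e\<in>E. x - e)"
          by (rule endpoint_sign_prod_nonneg[OF assms(1,2) x])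
        ultimately have "0 \<le> ddiff f (insert x Z) * ((endpoint_sign b E * (\<Prod>e\<in>E. x - e)) *
            (\<Prod>y\<in>Y. (x - y) * (x - (y + h))))"
          by (simp only: mult_nonneg_nonneg)
        also have "\<dots> = endpoint_sign b E * (f x - poly p x)"
          by (simp add: rem \<open>(\<Prod>z\<in>Z. x - z) = _\<close>)
        finally show ?thesis using \<open>0 \<le> C\<close> h by (meson order_trans mult_nonneg_nonneg less_imp_le neg_le_0_iff_le)
      qed
    qed
    moreover have "degree p \<le> n" using degree_interpolant[OF Z(1), of f] Z(2) by (simp add: p_def)
    moreover have "poly p x = f x" if "x \<in> E \<union> Y" for x
      using that Z(1) by (auto simp: p_def Z_def W_def intro: poly_interpolant)
    ultimately show ?thesis by blast
  qed
  show ?thesis by (rule that[OF h0 main])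
qed

subsection \<open>Integral inequalities\<close>

lemma integrable_on_interval_prob_space:
  assumes "prob_space \<mu>" "sets \<mu> = sets (restrict_space borel {a..b})"
    and "f \<in> borel_measurable (restrict_space borel {a..b})"
    and "\<And>x. x \<in> {a..b} \<Longrightarrow> \<bar>f x\<bar> \<le> (B :: real)"
  shows "integrable \<mu> f"
proof -
  interpret prob_space \<mu> by fact
  have "space \<mu> = {a..b}"
    using sets_eq_imp_space_eq[OF assms(2)] by (simp add: space_restrict_space)
  then have "AE x in \<mu>. norm (f x) \<le> B" using assms(4) by (intro AE_I2) auto
  moreover have "f \<in> borel_measurable \<mu>"
    using assms(3) by (subst measurable_cong_sets[OF assms(2) refl])
  ultimately show ?thesis by (rule integrable_const_bound)
qed

lemma n_convex_on_integrable:
  assumes "a < b" "prob_space \<mu>" "sets \<mu> = sets (restrict_space borel {a..b})"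
    and "n_convex_on n {a..b} f"
  shows "integrable \<mu> f"
proof -
  obtain B where "\<And>x. x \<in> {a..b} \<Longrightarrow> \<bar>f x\<bar> \<le> B"
    using n_convex_on_bounded[OF assms(1,4)] by blast
  then show ?thesis
    by (rule integrable_on_interval_prob_space[OF assms(2,3) n_convex_on_measurable[OF assms(1,4)]])
qed

lemma integrable_poly_on_interval_prob_space:
  fixes p :: "real poly"
  assumes "prob_space \<mu>" "sets \<mu> = sets (restrict_space borel {a..b})"
  shows "integrable \<mu> (poly p)"
proof -
  obtain M where "\<And>x. x \<in> {a..b} \<Longrightarrow> \<bar>poly p x\<bar> \<le> M"
    using poly_bounded_on_interval[where p = p and a = a and b = b] by blast
  moreover have "poly p \<in> borel_measurable (restrict_space borel {a..b})"
    by (intro measurable_restrict_space1 borel_measurable_continuous_onI continuous_intros)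
  ultimately show ?thesis using integrable_on_interval_prob_space[OF assms] by blast
qed

lemma lebesgue_integral_poly_of_moments:
  fixes p :: "real poly"
  assumes "a < b" "prob_space \<mu>" "sets \<mu> = sets (restrict_space borel {a..b})"
    and moments: "\<And>k. k \<in> {1..n} \<Longrightarrow>
           (\<integral>x. x ^ k \<partial>\<mu>) = 1 / (b - a) * integral {a..b} (\<lambda>x. x ^ k)"
    and "degree p \<le> n"
  shows "(\<integral>x. poly p x \<partial>\<mu>) = 1 / (b - a) * integral {a..b} (poly p)"
proof -
  interpret prob_space \<mu> by fact
  have eq: "poly p = (\<lambda>x. \<Sum>i\<le>degree p. coeff p i * x ^ i)" by (auto simp: poly_altdef)
  have "integrable \<mu> (\<lambda>x. x ^ i)" for i
    using integrable_poly_on_interval_prob_space[OF assms(2,3), of "monom 1 i"]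
    by (simp add: poly_monom[abs_def])
  then have "(\<integral>x. poly p x \<partial>\<mu>) = (\<Sum>i\<le>degree p. coeff p i * (\<integral>x. x ^ i \<partial>\<mu>))"
    unfolding eq by simp
  also have "\<dots> = (\<Sum>i\<le>degree p. coeff p i * (1 / (b - a) * integral {a..b} (\<lambda>x. x ^ i)))"
  proof (rule sum.cong)
    fix i assume "i \<in> {..degree p}"
    then show "coeff p i * (\<integral>x. x ^ i \<partial>\<mu>) = coeff p i * (1 / (b - a) * integral {a..b} (\<lambda>x. x ^ i))"
      \<comment> \<open>The moment hypothesis starts at exponent 1; exponent 0 is the total mass of
        the probability measure.\<close>
      using assms(1,5) moments[of i] by (cases "i = 0") (auto simp: prob_space)
  qed simp
  also have "\<dots> = 1 / (b - a) * (\<Sum>i\<le>degree p. coeff p i * integral {a..b} (\<lambda>x. x ^ i))"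
    by (simp add: sum_distrib_left mult.left_commute)
  also have "(\<Sum>i\<le>degree p. coeff p i * integral {a..b} (\<lambda>x. x ^ i)) = integral {a..b} (poly p)"
    unfolding eq
    by (subst integral_sum)
      (auto intro!: integrable_continuous_real continuous_intros)
  finally show ?thesis .
qed

lemma gauss_type_quadrature_bound:
  assumes "a < b" "prob_space \<mu>" "sets \<mu> = sets (restrict_space borel {a..b})"
    and moments: "\<And>k. k \<in> {1..n} \<Longrightarrow>
           (\<integral>x. x ^ k \<partial>\<mu>) = 1 / (b - a) * integral {a..b} (\<lambda>x. x ^ k)"
    and "E \<subseteq> {a, b}" "n + 1 = 2 * k + card E" and f: "n_convex_on n {a..b} f"
  shows "0 \<le> endpoint_sign b E * ((\<integral>x. f x \<partial>\<mu>) -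
    (THE Q. \<exists>X. quadrature_with_nodes a b (card E + k) X Q \<and> E \<subseteq> X \<and> exact_up_to_degree a b n Q) f)"
proof -
  interpret prob_space \<mu> by fact
  obtain Y \<alpha> where Y: "finite Y" "Y \<subseteq> {a<..<b}" "card Y = k"
    and exact: "exact_up_to_degree a b n (\<lambda>f. \<Sum>x\<in>E \<union> Y. \<alpha> x * f x)"
    and THE_eq: "(THE Q. \<exists>X. quadrature_with_nodes a b (card E + k) X Q \<and> E \<subseteq> X \<and>
           exact_up_to_degree a b n Q) = (\<lambda>f. \<Sum>x\<in>E \<union> Y. \<alpha> x * f x)"
    using gauss_type_quadrature[OF assms(1,5,6)] .
  obtain h0 C where h0: "0 < h0"
    and near: "\<And>h. 0 < h \<Longrightarrow> h < h0 \<Longrightarrow> \<exists>p. degree p \<le> n \<and> (\<forall>x\<in>E \<union> Y. poly p x = f x) \<and>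
           (\<forall>x\<in>{a..b}. - (C * h) \<le> endpoint_sign b E * (f x - poly p x))"
    using n_convex_on_near_osculation[OF assms(1,5,6) Y f] by metis
  define v where "v = endpoint_sign b E * ((\<integral>x. f x \<partial>\<mu>) - (\<Sum>x\<in>E \<union> Y. \<alpha> x * f x))"
  have int: "integrable \<mu> f"
    by (rule n_convex_on_integrable[OF assms(1-3) f])
  have space: "space \<mu> = {a..b}"
    using sets_eq_imp_space_eq[OF assms(3)] by (simp add: space_restrict_space)
  have lower: "- (C * h) \<le> v" if h: "0 < h" "h < h0" for h
  proof -
    obtain p where p: "degree p \<le> n" "\<And>x. x \<in> E \<union> Y \<Longrightarrow> poly p x = f x"
      "\<And>x. x \<in> {a..b} \<Longrightarrow> - (C * h) \<le> endpoint_sign b E * (f x - poly p x)"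
      using near[OF h] by blast
    have intp: "integrable \<mu> (poly p)"
      by (rule integrable_poly_on_interval_prob_space[OF assms(2,3)])
    \<comment> \<open>f and p agree at the nodes, and the degree of p is at most n, so the rule and
      \<mu> both give the mean value of p.\<close>
    have "(\<Sum>x\<in>E \<union> Y. \<alpha> x * f x) = (\<Sum>x\<in>E \<union> Y. \<alpha> x * poly p x)"
      using p(2) by (intro sum.cong) auto
    also have "\<dots> = 1 / (b - a) * integral {a..b} (poly p)"
      using exact p(1) by (simp add: exact_up_to_degree_def)
    also have "\<dots> = (\<integral>x. poly p x \<partial>\<mu>)"
      using lebesgue_integral_poly_of_moments[OF assms(1-3) moments p(1)] by simp
    finally have "v = (\<integral>x. endpoint_sign b E * (f x - poly p x) \<partial>\<mu>)"
      using int intp by (simp add: v_def)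
    moreover have "(\<integral>x. - (C * h) \<partial>\<mu>) \<le> (\<integral>x. endpoint_sign b E * (f x - poly p x) \<partial>\<mu>)"
      using int intp p(3) space by (intro integral_mono) auto
    ultimately show ?thesis by (simp add: prob_space)
  qed
  have "((\<lambda>h. - (C * h)) \<longlongrightarrow> - (C * 0)) (at_right 0)"
    by (intro tendsto_intros)
  moreover have "eventually (\<lambda>h. - (C * h) \<le> v) (at_right 0)"
    unfolding eventually_at_right_field using h0 lower by blast
  ultimately have "- (C * 0) \<le> v"
    by (rule tendsto_upperbound) simp
  then show ?thesis by (simp add: v_def THE_eq)
qed

theorem theorem3:
  fixes n :: nat and a b :: real and \<mu> :: "real measure"
  assumes "0 < n" and "a < b"
    and "prob_space \<mu>" and "sets \<mu> = sets (restrict_space borel {a..b})"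
    and "\<And>k. k \<in> {1..n} \<Longrightarrow>
           (\<integral>x. x ^ k \<partial>\<mu>) = 1 / (b - a) * integral {a..b} (\<lambda>x. x ^ k)"
  shows "(odd n \<longrightarrow> (\<forall>f. n_convex_on n {a..b} f \<longrightarrow>
            integrable \<mu> f \<and>
            Gauss_quadrature ((n + 1) div 2) a b f \<le> (\<integral>x. f x \<partial>\<mu>) \<and>
            (\<integral>x. f x \<partial>\<mu>) \<le> Lobatto_quadrature ((n + 3) div 2) a b f)) \<and>
         (even n \<longrightarrow> (\<forall>f. n_convex_on n {a..b} f \<longrightarrow>
            integrable \<mu> f \<and>
            left_Radau_quadrature ((n + 2) div 2) a b f \<le> (\<integral>x. f x \<partial>\<mu>) \<and>
            (\<integral>x. f x \<partial>\<mu>) \<le> right_Radau_quadrature ((n + 2) div 2) a b f))"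
proof -
  \<comment> \<open>Integrability is established separately because the Bochner integral of a
    non-integrable function has the default value 0.\<close>
  have int: "integrable \<mu> f" if "n_convex_on n {a..b} f" for f
    using n_convex_on_integrable[OF assms(2-4) that] .
  note bound = gauss_type_quadrature_bound[OF assms(2-5)]
  have odd: "Gauss_quadrature ((n + 1) div 2) a b f \<le> (\<integral>x. f x \<partial>\<mu>) \<and>
      (\<integral>x. f x \<partial>\<mu>) \<le> Lobatto_quadrature ((n + 3) div 2) a b f"
    if "odd n" and f: "n_convex_on n {a..b} f" for f
  proof -
    \<comment> \<open>With m = k+1 for Gauss and m = k+2 for Lobatto, the prescribed degrees 2m-1
      and 2m-3 both equal n.\<close>
    obtain k where n: "n = 2 * k + 1" using \<open>odd n\<close> by (rule oddE)
    have "0 \<le> endpoint_sign b {} * ((\<integral>x. f x \<partial>\<mu>) - Gauss_quadrature (k + 1) a b f)"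
      using bound[where E = "{}" and k = "k + 1" and f = f] f by (simp add: Gauss_quadrature_def n)
    moreover have "0 \<le> endpoint_sign b {a, b} * ((\<integral>x. f x \<partial>\<mu>) - Lobatto_quadrature (k + 2) a b f)"
      using bound[where E = "{a, b}" and k = k and f = f] f assms(2) by (simp add: Lobatto_quadrature_def n conj_assoc)
    ultimately show ?thesis by (simp add: endpoint_sign_def n)
  qed
  have even: "left_Radau_quadrature ((n + 2) div 2) a b f \<le> (\<integral>x. f x \<partial>\<mu>) \<and>
      (\<integral>x. f x \<partial>\<mu>) \<le> right_Radau_quadrature ((n + 2) div 2) a b f"
    if "even n" and f: "n_convex_on n {a..b} f" for f
  proof -
    \<comment> \<open>Both Radau rules have m = k+1 nodes, one at an endpoint, and the prescribed
      degree 2m-2 equals n.\<close>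
    obtain k where n: "n = 2 * k" using \<open>even n\<close> by (rule evenE)
    have "0 \<le> endpoint_sign b {a} * ((\<integral>x. f x \<partial>\<mu>) - left_Radau_quadrature (k + 1) a b f)"
      using bound[where E = "{a}" and k = k and f = f] f by (simp add: left_Radau_quadrature_def n)
    moreover have "0 \<le> endpoint_sign b {b} * ((\<integral>x. f x \<partial>\<mu>) - right_Radau_quadrature (k + 1) a b f)"
      using bound[where E = "{b}" and k = k and f = f] f by (simp add: right_Radau_quadrature_def n)
    ultimately show ?thesis using assms(2) by (simp add: endpoint_sign_def n)
  qed
  show ?thesis using int odd even by blast
qed

end
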